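(* For any integer $n>2$, the largest Laplacian eigenvalue of the comaximal graph $\Gamma(\mathbb{Z}_n)$ is $\lambda_1=n$, and it has multiplicity exactly $\phi(n)$.
   Context: The comaximal graph $\Gamma(\mathbb{Z}_n)$ has vertex set $\mathbb{Z}_n=\{0,1,\dots,n-1\}$, distinct $x,y$ adjacent iff $\langle x\rangle+\langle y\rangle=\mathbb{Z}_n$. Its Laplacian matrix is $L=D-A$ ($D$ diagonal degree matrix, $A$ adjacency matrix). $\phi$ is Euler's totient function. *)

theory Defs
  imports
    "HOL-Number_Theory.Residues"
    "HOL-Number_Theory.Totient"
    "Jordan_Normal_Form.Char_Poly"
begin

text \<open>The vertices of the comaximal graph are the elements \<open>0, \<dots>, n - 1\<close> of
  \<open>residue_ring (int n)\<close>, indexed by natural numbers so that they also index matrices.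
  For \<open>n \<ge> 2\<close> that structure is a ring; \<open>PIdl\<close> gives principal ideals and
  \<open><+>\<close> their elementwise sum.\<close>

definition comaximal_adj :: "nat \<Rightarrow> nat \<Rightarrow> nat \<Rightarrow> bool" where
  "comaximal_adj n x y \<longleftrightarrow>
     x < n \<and> y < n \<and> x \<noteq> y \<and>
     (PIdl\<^bsub>residue_ring (int n)\<^esub> (int x)) <+>\<^bsub>residue_ring (int n)\<^esub>
       (PIdl\<^bsub>residue_ring (int n)\<^esub> (int y)) = carrier (residue_ring (int n))"

text \<open>Matrices of a simple graph on the vertex set \<open>{0..<n}\<close> with adjacency relation \<open>E\<close>.\<close>

definition adjacency_matrix :: "nat \<Rightarrow> (nat \<Rightarrow> nat \<Rightarrow> bool) \<Rightarrow> real mat" where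
  "adjacency_matrix n E = mat n n (\<lambda>(i, j). if E i j then 1 else 0)"

definition degree_matrix :: "nat \<Rightarrow> (nat \<Rightarrow> nat \<Rightarrow> bool) \<Rightarrow> real mat" where
  "degree_matrix n E =
     mat n n (\<lambda>(i, j). if i = j then real (card {k. k < n \<and> E i k}) else 0)"

definition laplacian_matrix :: "nat \<Rightarrow> (nat \<Rightarrow> nat \<Rightarrow> bool) \<Rightarrow> real mat" where
  "laplacian_matrix n E = degree_matrix n E - adjacency_matrix n E"

definition comaximal_laplacian :: "nat \<Rightarrow> real mat" where
  "comaximal_laplacian n = laplacian_matrix n (comaximal_adj n)"

end

theory Submission
  imports Defs
begin

text \<open>The units of \<open>\<int>\<^sub>n\<close> are adjacent to every other vertex, while \<open>0\<close> is adjacent to the units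
  only. Let \<open>L\<close> be the Laplacian. Subtracting the mean of all rows from the row of a unit \<open>u\<close> in
  \<open>X I - L\<close> leaves \<open>(X - n) (e\<^sub>u - 1/n)\<close>, so \<open>(X - n)\<close> can be extracted \<open>\<phi>(n)\<close> times from the
  characteristic polynomial. What remains is nonsingular at \<open>X = n\<close>: a kernel vector has sum zero,
  vanishes on the units, and is harmonic on the complement graph of the non-units, which is
  connected through \<open>0\<close>. For the bound on the eigenvalues, compare both sides of
  \<open>L v = \<mu> v\<close> at a maximal entry of \<open>v\<close>.\<close>

section \<open>Determinants\<close>

text \<open>Contrapositive of the fact that a singular matrix over a field kills a nonzero vector;
  vectors are plain functions here, so that kernels can be handled as systems of sums.\<close>

lemma det_mat_nonzeroI:
  fixes f :: "nat \<Rightarrow> nat \<Rightarrow> 'a :: field"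
  assumes "\<And>v j. (\<And>i. i < n \<Longrightarrow> (\<Sum>j=0..<n. f i j * v j) = 0) \<Longrightarrow> j < n \<Longrightarrow> v j = 0"
  shows "det (mat n n (\<lambda>(i, j). f i j)) \<noteq> 0"
proof
  let ?A = "mat n n (\<lambda>(i, j). f i j)"
  assume "det ?A = 0"
  then obtain v where v: "v \<in> carrier_vec n" "v \<noteq> 0\<^sub>v n" "?A *\<^sub>v v = 0\<^sub>v n"
    using det_0_iff_vec_prod_zero_field[of ?A n] by auto
  have "(\<Sum>j=0..<n. f i j * v $ j) = 0" if "i < n" for i
  proof -
    have "(?A *\<^sub>v v) $ i = (\<Sum>j=0..<n. f i j * v $ j)"
      using that v(1) by (simp add: scalar_prod_def)
    with v(3) that show ?thesis by simp
  qed
  from assms[of "\<lambda>j. v $ j", OF this] have "v = 0\<^sub>v n"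
    using v(1) by (intro eq_vecI) auto
  with v(2) show False by simp
qed

text \<open>Each term of the Leibniz formula takes exactly one entry from every row, so it contains
  every \<open>c i\<close> once.\<close>

lemma det_mat_row_mult:
  fixes c :: "nat \<Rightarrow> 'a :: comm_ring_1"
  shows "det (mat n n (\<lambda>(i, j). c i * f i j)) = (\<Prod>i=0..<n. c i) * det (mat n n (\<lambda>(i, j). f i j))"
proof -
  have "(\<Prod>i=0..<n. mat n n (\<lambda>(i, j). c i * f i j) $$ (i, p i)) =
      (\<Prod>i=0..<n. c i) * (\<Prod>i=0..<n. mat n n (\<lambda>(i, j). f i j) $$ (i, p i))"
    if "p permutes {0..<n}" for p
    unfolding prod.distrib[symmetric] using permutes_in_image[OF that]
    by (intro prod.cong) auto
  then show ?thesis
    unfolding det_def'[OF mat_carrier] sum_distrib_left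
    by (intro sum.cong) (auto simp: mult_ac)
qed

section \<open>Laplacians of graphs with dominating vertices\<close>

lemma laplacian_matrix_carrier [simp]: "laplacian_matrix n E \<in> carrier_mat n n"
  unfolding laplacian_matrix_def degree_matrix_def adjacency_matrix_def
  by (intro minus_carrier_mat mat_carrier)

lemma index_laplacian_matrix:
  assumes "i < n" "j < n"
  shows "laplacian_matrix n E $$ (i, j) =
    (if i = j then real (card {k. k < n \<and> E i k}) else 0) - (if E i j then 1 else 0)"
  using assms by (simp add: laplacian_matrix_def degree_matrix_def adjacency_matrix_def)

text \<open>The degree counts the neighbours of \<open>i\<close>, so its multiple of
  \<open>v i\<close> can be spread over the edges at \<open>i\<close>.\<close>

lemma laplacian_matrix_sum:
  assumes "i < n"
  shows "(\<Sum>j=0..<n. laplacian_matrix n E $$ (i, j) * v j) =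
    (\<Sum>j=0..<n. if E i j then v i - v j else 0)"
proof -
  have "(\<Sum>j=0..<n. laplacian_matrix n E $$ (i, j) * v j) =
      (\<Sum>j=0..<n. (if i = j then real (card {k. k < n \<and> E i k}) * v i else 0)
        - (if E i j then v j else 0))"
    using assms by (intro sum.cong) (auto simp: index_laplacian_matrix algebra_simps)
  also have "\<dots> = real (card {k. k < n \<and> E i k}) * v i - (\<Sum>j=0..<n. if E i j then v j else 0)"
    using assms by (simp add: sum_subtractf)
  also have "real (card {k. k < n \<and> E i k}) * v i = (\<Sum>j=0..<n. if E i j then v i else 0)"
  proof -
    have "{k. k < n \<and> E i k} = {0..<n} \<inter> {k. E i k}" by auto
    then show ?thesis by (simp add: sum.If_cases)
  qed
  also have "\<dots> - (\<Sum>j=0..<n. if E i j then v j else 0) =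
      (\<Sum>j=0..<n. if E i j then v i - v j else 0)"
    by (auto simp flip: sum_subtractf intro!: sum.cong)
  finally show ?thesis .
qed

text \<open>By symmetry this is a row sum, that is, the Laplacian applied to the constant function
  1.\<close>

lemma laplacian_matrix_column_sum:
  assumes "\<And>i j. E i j \<longleftrightarrow> E j i" and "j < n"
  shows "(\<Sum>i=0..<n. laplacian_matrix n E $$ (i, j)) = 0"
proof -
  have "(\<Sum>i=0..<n. laplacian_matrix n E $$ (i, j)) = (\<Sum>i=0..<n. laplacian_matrix n E $$ (j, i) * 1)"
    using assms by (intro sum.cong) (auto simp: index_laplacian_matrix)
  also have "\<dots> = 0"
    using laplacian_matrix_sum[OF \<open>j < n\<close>, of E "\<lambda>_. 1"] by (simp cong: if_cong)
  finally show ?thesis .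
qed

lemma laplacian_eigenvalue_le:
  assumes sym: "\<And>i j. E i j \<longleftrightarrow> E j i"
    and ev: "eigenvalue (laplacian_matrix n E) \<mu>"
  shows "\<mu> \<le> real n"
proof (cases "\<mu> = 0")
  case False
  let ?L = "laplacian_matrix n E"
  have dim: "dim_row ?L = n" using laplacian_matrix_carrier carrier_matD by blast
  obtain v where v: "v \<in> carrier_vec n" "v \<noteq> 0\<^sub>v n" "?L *\<^sub>v v = \<mu> \<cdot>\<^sub>v v"
    using ev by (auto simp: eigenvalue_def eigenvector_def dim)
  have row: "\<mu> * v $ i = (\<Sum>j=0..<n. ?L $$ (i, j) * v $ j)" if "i < n" for i
  proof -
    have "(?L *\<^sub>v v) $ i = (\<Sum>j=0..<n. ?L $$ (i, j) * v $ j)"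
      using that v(1) carrier_matD[OF laplacian_matrix_carrier[of n E]]
      by (simp add: scalar_prod_def)
    then show ?thesis using v(1,3) that by simp
  qed
  \<comment> \<open>Vanishing column sums force an eigenvector with \<mu> nonzero to have entry sum
    0.\<close>
  have "\<mu> * (\<Sum>i=0..<n. v $ i) = (\<Sum>j=0..<n. \<Sum>i=0..<n. ?L $$ (i, j) * v $ j)"
    unfolding sum_distrib_left by (subst sum.swap) (simp add: row)
  also have "\<dots> = 0"
    by (simp add: laplacian_matrix_column_sum[OF sym] flip: sum_distrib_right)
  finally have sum0: "(\<Sum>i=0..<n. v $ i) = 0" using False by simp
  have n: "n > 0" using v(1,2) by (cases n) auto
  define m where "m = Max ((\<lambda>i. v $ i) ` {0..<n})"
  have "m \<in> (\<lambda>i. v $ i) ` {0..<n}" unfolding m_def using n by (intro Max_in) auto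
  then obtain i where i: "i < n" "v $ i = m" by auto
  have le: "v $ j \<le> v $ i" if "j < n" for j
    unfolding i m_def using that by (intro Max_ge) auto
  have pos: "v $ i > 0"
  proof (rule ccontr)
    assume "\<not> v $ i > 0"
    then have nonneg: "0 \<le> - v $ j" if "j < n" for j using le[OF that] by simp
    have "(\<Sum>j=0..<n. - v $ j) = 0" using sum0 by (simp add: sum_negf)
    then have "\<forall>j\<in>{0..<n}. - v $ j = 0"
      using nonneg by (subst (asm) sum_nonneg_eq_0_iff) auto
    then have "v = 0\<^sub>v n" using v(1) by (intro eq_vecI) auto
    with v(2) show False by simp
  qed
  have "\<mu> * v $ i = (\<Sum>j=0..<n. if E i j then v $ i - v $ j else 0)"
    using row[OF i(1)] laplacian_matrix_sum[OF i(1), of E "\<lambda>j. v $ j"] by simp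
  \<comment> \<open>Since \<open>v $ i\<close> is maximal, including the non-neighbours only adds
    nonnegative terms.\<close>
  also have "\<dots> \<le> (\<Sum>j=0..<n. v $ i - v $ j)"
    using le by (intro sum_mono) auto
  also have "\<dots> = real n * v $ i" using sum0 by (simp add: sum_subtractf)
  finally show ?thesis using pos by simp
qed simp

text \<open>\<open>U\<close> abstracts the units and \<open>z\<close> the residue 0. In the
  complement graph \<open>z\<close> is joined to every other vertex outside \<open>U\<close>, which
  makes that part connected.\<close>

locale dominated_graph =
  fixes n :: nat and E :: "nat \<Rightarrow> nat \<Rightarrow> bool" and U :: "nat set" and z :: nat
  assumes irrefl: "\<not> E i i"
    and sym: "E i j \<longleftrightarrow> E j i"
    and U_subset: "U \<subseteq> {0..<n}"
    and dominating: "u \<in> U \<Longrightarrow> j < n \<Longrightarrow> j \<noteq> u \<Longrightarrow> E u j"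
    and z: "z < n" "z \<notin> U"
    and neighbours_z: "j < n \<Longrightarrow> E z j \<Longrightarrow> j \<in> U"
begin

lemma card_U_less: "card U < n"
proof -
  have "U \<subset> {0..<n}" using U_subset z by auto
  from psubset_card_mono[OF _ this] show ?thesis by simp
qed

lemma degree_dominating:
  assumes "u \<in> U" shows "real (card {k. k < n \<and> E u k}) = real n - 1"
proof -
  have "{k. k < n \<and> E u k} = {0..<n} - {u}"
    using assms dominating irrefl by auto
  moreover have "u < n" using assms U_subset by auto
  ultimately show ?thesis by (simp add: of_nat_diff)
qed

text \<open>Antisymmetry of differences over the complement graph forces the total sum to 0, hence
  \<open>v\<close> vanishes on \<open>U\<close>. A maximum principle then makes \<open>v\<close>
  constant off \<open>U\<close>, and that constant is 0 because the total is 0.\<close>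

lemma kernel_trivial:
  fixes v :: "nat \<Rightarrow> real"
  assumes dom: "\<And>i. i \<in> U \<Longrightarrow> real n * v i = (\<Sum>j=0..<n. v j)"
    and ndom: "\<And>i. i < n \<Longrightarrow> i \<notin> U \<Longrightarrow>
      real n * v i = (\<Sum>j=0..<n. if E i j then v i - v j else 0)"
    and "k < n"
  shows "v k = 0"
proof -
  define N where "N = {0..<n} - U"
  define S where "S = (\<Sum>j=0..<n. v j)"
  \<comment> \<open>Differences along the edges of the complement graph; the diagonal contributes
    0.\<close>
  define d where "d i j = (if E i j then 0 else v i - v j)" for i j
  have n: "n > 0" using z by simp
  have harm: "(\<Sum>j\<in>N. d i j) + S = 0" if "i \<in> N" for i
  proof -
    have i: "i < n" "i \<notin> U" using that by (auto simp: N_def)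
    have "E i u" if "u \<in> U" for u using dominating[of u i] i sym that by auto
    then have "(\<Sum>j\<in>N. d i j) = (\<Sum>j=0..<n. d i j)"
      by (intro sum.mono_neutral_left) (auto simp: N_def d_def)
    also have "\<dots> = (\<Sum>j=0..<n. (v i - v j) - (if E i j then v i - v j else 0))"
      by (intro sum.cong) (auto simp: d_def)
    also have "\<dots> = - S"
      using ndom[OF i] by (simp add: sum_subtractf S_def)
    finally show ?thesis by simp
  qed
  \<comment> \<open>\<open>d\<close> is antisymmetric, so its double sum is its own
    negative.\<close>
  have "(\<Sum>i\<in>N. \<Sum>j\<in>N. d i j) = - (\<Sum>i\<in>N. \<Sum>j\<in>N. d j i)"
    unfolding sum_negf[symmetric] by (intro sum.cong) (auto simp: d_def sym)
  also have "(\<Sum>i\<in>N. \<Sum>j\<in>N. d j i) = (\<Sum>i\<in>N. \<Sum>j\<in>N. d i j)"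
    by (rule sum.swap)
  finally have "(\<Sum>i\<in>N. \<Sum>j\<in>N. d i j) = 0" by simp
  moreover have "(\<Sum>i\<in>N. (\<Sum>j\<in>N. d i j) + S) = 0" using harm by simp
  ultimately have "real (card N) * S = 0" by (simp add: sum.distrib)
  moreover have zN: "z \<in> N" and fin: "finite N" using z by (auto simp: N_def)
  ultimately have S: "S = 0" using card_gt_0_iff[of N] by auto
  have vU: "v u = 0" if "u \<in> U" for u using dom[OF that] S n by (simp add: S_def)
  have vz: "v i = v z" if i: "i \<in> N" and extremal:
    "(\<forall>j\<in>N. v i \<le> v j) \<or> (\<forall>j\<in>N. v j \<le> v i)" for i
  proof -
    \<comment> \<open>At an extremal entry all \<open>d i j\<close> have one sign and sum to 0, so
      each is 0; as \<open>z\<close> is not adjacent to \<open>i\<close>, \<open>d i z\<close> is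
      the full difference.\<close>
    have "(\<Sum>j\<in>N. \<bar>d i j\<bar>) = 0"
      using extremal
    proof
      assume "\<forall>j\<in>N. v i \<le> v j"
      then have "(\<Sum>j\<in>N. \<bar>d i j\<bar>) = (\<Sum>j\<in>N. - d i j)" by (intro sum.cong) (auto simp: d_def)
      then show ?thesis using harm[OF i] S by (simp add: sum_negf)
    next
      assume "\<forall>j\<in>N. v j \<le> v i"
      then have "(\<Sum>j\<in>N. \<bar>d i j\<bar>) = (\<Sum>j\<in>N. d i j)" by (intro sum.cong) (auto simp: d_def)
      then show ?thesis using harm[OF i] S by simp
    qed
    then have "d i z = 0" using fin zN by (subst (asm) sum_nonneg_eq_0_iff) auto
    moreover have "\<not> E i z" using i neighbours_z[of i] sym by (auto simp: N_def)
    ultimately show ?thesis by (simp add: d_def)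
  qed
  have img: "finite (v ` N)" "v ` N \<noteq> {}" using fin zN by auto
  obtain a where a: "a \<in> N" "v a = Min (v ` N)" using Min_in[OF img] by auto
  obtain b where b: "b \<in> N" "v b = Max (v ` N)" using Max_in[OF img] by auto
  have "v a = v z" using a img by (intro vz) auto
  moreover have "v b = v z" using b img by (intro vz) auto
  ultimately have const: "v i = v z" if "i \<in> N" for i
    using a b img that by (metis Max_ge Min_le antisym imageI)
  have "0 = (\<Sum>j\<in>N. v j)"
    unfolding S[unfolded S_def, symmetric] N_def
    using vU U_subset by (intro sum.mono_neutral_right) auto
  also have "\<dots> = real (card N) * v z" using const by simp
  finally have "v z = 0" using fin zN card_gt_0_iff[of N] by auto
  then show ?thesis using const vU \<open>k < n\<close> by (cases "k \<in> U") (auto simp: N_def)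
qed

text \<open>Multiplying by \<open>R\<close> performs row operations after which each row in
  \<open>U\<close> is divisible by \<open>X - n\<close>. Determinants then split off
  \<open>card U\<close> such factors, and neither \<open>det R\<close> nor \<open>det Q\<close>
  vanishes at \<open>n\<close>.\<close>

lemma order_char_poly_laplacian:
  "order (real n) (char_poly (laplacian_matrix n E)) = card U"
proof -
  let ?L = "laplacian_matrix n E"
  let ?P = "char_poly_matrix ?L"
  \<comment> \<open>\<open>c i\<close> is the multiple of the sum of all rows that is subtracted
    from row \<open>i\<close>: the mean for \<open>U\<close>, nothing elsewhere. \<open>w\<close>
    collects the extracted factors and \<open>Q\<close> the reduced rows.\<close>
  define c where "c i = (if i \<in> U then 1 / real n else 0)" for i
  define r where "r i j = (if i = j then 1 else 0) - c i" for i j :: nat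
  define R where "R = mat n n (\<lambda>(i, j). [:r i j:])"
  define q where "q i j = (if i \<in> U then [:r i j:] else ?P $$ (i, j))" for i j
  define w where "w i = (if i \<in> U then [:- real n, 1:] else 1)" for i
  define Q where "Q = mat n n (\<lambda>(i, j). q i j)"
  have n: "n > 0" using z by simp
  have P: "?P \<in> carrier_mat n n" by simp
  have dimP: "dim_row ?P = n" "dim_col ?P = n" using P by (auto simp del: char_poly_matrix_closed)
  have index_P: "?P $$ (i, j) = (if i = j then [:0, 1:] else 0) - [:?L $$ (i, j):]"
    if "i < n" "j < n" for i j
    using that carrier_matD[OF laplacian_matrix_carrier[of n E]] by (simp add: char_poly_matrix_def)
  have const_sum: "(\<Sum>i\<in>A. [:f i:]) = [:\<Sum>i\<in>A. f i:]" for f :: "nat \<Rightarrow> real" and A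
    by (induction A rule: infinite_finite_induct) auto
  have colsum: "(\<Sum>i=0..<n. ?P $$ (i, j)) = [:0, 1:]" if "j < n" for j
  proof -
    have "(\<Sum>i=0..<n. ?P $$ (i, j)) = (\<Sum>i=0..<n. if i = j then [:0, 1:] else 0)
        - (\<Sum>i=0..<n. [:?L $$ (i, j):])"
      using that by (simp add: index_P sum_subtractf)
    then show ?thesis
      using that laplacian_matrix_column_sum[of E, OF sym that] by (simp add: const_sum)
  qed
  have "R * ?P = mat n n (\<lambda>(i, j). w i * q i j)"
  proof (intro eq_matI)
    fix i j assume "i < dim_row (mat n n (\<lambda>(i, j). w i * q i j))"
      and "j < dim_col (mat n n (\<lambda>(i, j). w i * q i j))"
    then have ij: "i < n" "j < n" by auto
    have "(R * ?P) $$ (i, j) = (\<Sum>k=0..<n. [:r i k:] * ?P $$ (k, j))"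
      using ij dimP by (simp add: R_def scalar_prod_def)
    also have "\<dots> = (\<Sum>k=0..<n. (if i = k then ?P $$ (k, j) else 0) - [:c i:] * ?P $$ (k, j))"
      by (intro sum.cong) (auto simp: r_def algebra_simps)
    also have "\<dots> = ?P $$ (i, j) - [:c i:] * (\<Sum>k=0..<n. ?P $$ (k, j))"
      using ij by (simp add: sum_subtractf sum_distrib_left)
    also have "\<dots> = ?P $$ (i, j) - [:0, c i:]" using ij colsum by simp
    \<comment> \<open>For \<open>i\<close> in \<open>U\<close> the diagonal entry is
      \<open>X - n + 1 - X/n = (X - n) (1 - 1/n)\<close>, and any other entry is
      \<open>1 - X/n = (X - n) (- 1/n)\<close>.\<close>
    also have "\<dots> = w i * q i j"
      using ij n dominating[of i j] irrefl[of i]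
      by (auto simp: w_def q_def c_def r_def index_P index_laplacian_matrix degree_dominating field_simps)
    finally show "(R * ?P) $$ (i, j) = mat n n (\<lambda>(i, j). w i * q i j) $$ (i, j)"
      using ij by simp
  qed (auto simp: R_def dimP)
  then have "det R * char_poly ?L = (\<Prod>i=0..<n. w i) * det Q"
    using det_mult[of R n ?P] P det_mat_row_mult[of n w q] by (simp add: R_def Q_def char_poly_def)
  also have "(\<Prod>i=0..<n. w i) = [:- real n, 1:] ^ card U"
    unfolding w_def using U_subset by (simp add: prod.If_cases Int_absorb1)
  finally have fact: "det R * char_poly ?L = [:- real n, 1:] ^ card U * det Q" .
  have "poly (det R) (real n) = det (mat n n (\<lambda>(i, j). r i j))"
    by (rule poly_det_cong[of _ n]) (auto simp: R_def)
  also have "\<dots> \<noteq> 0"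
  proof (rule det_mat_nonzeroI)
    fix v :: "nat \<Rightarrow> real" and k
    assume "\<And>i. i < n \<Longrightarrow> (\<Sum>j=0..<n. r i j * v j) = 0" and "k < n"
    moreover define S where "S = (\<Sum>j=0..<n. v j)"
    moreover have "(\<Sum>j=0..<n. r i j * v j) = v i - c i * S" if "i < n" for i
    proof -
      have "(\<Sum>j=0..<n. r i j * v j) = (\<Sum>j=0..<n. (if i = j then v j else 0) - c i * v j)"
        by (intro sum.cong) (auto simp: r_def algebra_simps)
      then show ?thesis using that by (simp add: sum_subtractf sum_distrib_left S_def)
    qed
    ultimately have v: "v i = c i * S" if "i < n" for i using that by simp
    \<comment> \<open>Summation gives \<open>S = (card U / n) * S\<close>, and
      \<open>card U < n\<close> leaves only \<open>S = 0\<close>.\<close>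
    have "S = (\<Sum>i=0..<n. c i * S)" unfolding S_def using v[unfolded S_def] by (intro sum.cong) auto
    also have "\<dots> = real (card U) / real n * S"
      using U_subset by (simp add: c_def sum.If_cases Int_absorb1 flip: sum_distrib_right)
    finally have "S = 0" using card_U_less by (auto simp: field_simps)
    with v \<open>k < n\<close> show "v k = 0" by simp
  qed
  finally have R0: "poly (det R) (real n) \<noteq> 0" .
  have "poly (det Q) (real n) = det (mat n n (\<lambda>(i, j). poly (q i j) (real n)))"
    by (rule poly_det_cong[of _ n]) (auto simp: Q_def)
  also have "\<dots> \<noteq> 0"
  proof (rule det_mat_nonzeroI)
    fix v :: "nat \<Rightarrow> real" and k
    assume ker: "\<And>i. i < n \<Longrightarrow> (\<Sum>j=0..<n. poly (q i j) (real n) * v j) = 0" and k: "k < n"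
    show "v k = 0"
    proof (rule kernel_trivial[OF _ _ k])
      fix i assume i: "i \<in> U"
      then have "i < n" using U_subset by auto
      \<comment> \<open>A reduced row says that \<open>v i\<close> is the mean of \<open>v\<close>;
        the other rows are those of \<open>n I - L\<close>.\<close>
      have "0 = (\<Sum>j=0..<n. (if i = j then v j else 0) - v j / real n)"
        using i by (subst ker[OF \<open>i < n\<close>, symmetric], intro sum.cong)
          (auto simp: q_def r_def c_def algebra_simps)
      also have "\<dots> = v i - (\<Sum>j=0..<n. v j) / real n"
        using \<open>i < n\<close> by (simp add: sum_subtractf sum_divide_distrib)
      finally show "real n * v i = (\<Sum>j=0..<n. v j)" using n by (simp add: field_simps)
    next
      fix i assume i: "i < n" "i \<notin> U"
      have "0 = (\<Sum>j=0..<n. (if i = j then real n * v j else 0) - ?L $$ (i, j) * v j)"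
        using i by (subst ker[OF i(1), symmetric], intro sum.cong)
          (auto simp: q_def index_P algebra_simps)
      also have "\<dots> = real n * v i - (\<Sum>j=0..<n. if E i j then v i - v j else 0)"
        using i by (simp add: sum_subtractf laplacian_matrix_sum)
      finally show "real n * v i = (\<Sum>j=0..<n. if E i j then v i - v j else 0)" by simp
    qed
  qed
  finally have Q0: "poly (det Q) (real n) \<noteq> 0" .
  have "det Q \<noteq> 0" using Q0 by auto
  then have ne: "[:- real n, 1:] ^ card U * det Q \<noteq> 0" by simp
  \<comment> \<open>\<open>det R\<close> has order 0 at \<open>n\<close>, so multiplying by it
    leaves the order unchanged.\<close>
  have "order (real n) (char_poly ?L) = order (real n) (det R * char_poly ?L)"
    by (simp add: order_mult[OF ne[folded fact]] order_0I[OF R0])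
  also have "\<dots> = card U"
    unfolding fact by (simp only: order_mult[OF ne] order_power_n_n order_0I[OF Q0] add_0_right)
  finally show ?thesis .
qed

end

section \<open>The comaximal graph\<close>

context residues
begin

lemma PIdl_add_commute:
  assumes "a \<in> carrier R" "b \<in> carrier R"
  shows "PIdl a <+>\<^bsub>R\<^esub> PIdl b = PIdl b <+>\<^bsub>R\<^esub> PIdl a"
proof -
  interpret cring R by (rule cring)
  have "PIdl a \<subseteq> carrier R" "PIdl b \<subseteq> carrier R" using assms by (auto simp: cgenideal_def)
  then show ?thesis using a_comm unfolding set_add_def' by blast
qed

text \<open>A residue coprime to \<open>m\<close> has an inverse \<open>b\<close>, and every
  \<open>x\<close> is the multiple \<open>(x \<otimes> b) \<otimes> a\<close>.\<close>

lemma PIdl_coprime: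
  assumes "coprime a m" "a \<in> carrier R"
  shows "PIdl a = carrier R"
proof -
  interpret cring R by (rule cring)
  have "a \<in> Units R" using assms m_gt_one
    by (auto simp: res_units_eq res_carrier_eq intro: le_neq_trans)
  then obtain b where b: "b \<in> carrier R" "b \<otimes> a = \<one>" by (auto simp: Units_def)
  have "x \<in> PIdl a" if "x \<in> carrier R" for x
    using that b assms by (auto simp: cgenideal_def m_assoc intro!: exI[of _ "x \<otimes> b"])
  moreover have "PIdl a \<subseteq> carrier R" using assms by (auto simp: cgenideal_def)
  ultimately show ?thesis by auto
qed

text \<open>This makes the units dominating: one summand is already the whole ring and the other
  contains zero.\<close>

lemma PIdl_coprime_add:
  assumes "coprime a m" "a \<in> carrier R" "b \<in> carrier R"
  shows "PIdl a <+>\<^bsub>R\<^esub> PIdl b = carrier R"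
proof -
  interpret cring R by (rule cring)
  have "\<zero> \<in> PIdl b" "PIdl b \<subseteq> carrier R" using assms
    by (auto simp: cgenideal_def intro!: exI[of _ \<zero>])
  then show ?thesis
    unfolding PIdl_coprime[OF assms(1,2)] set_add_def' by force
qed

text \<open>The zero ideal adds nothing, so \<open>\<one>\<close> is a multiple of \<open>b\<close>
  and \<open>b\<close> is invertible modulo \<open>m\<close>. Hence the neighbours of 0 are
  units.\<close>

lemma coprime_if_PIdl_zero_add:
  assumes "PIdl \<zero> <+>\<^bsub>R\<^esub> PIdl b = carrier R" "b \<in> carrier R"
  shows "coprime b m"
proof -
  interpret cring R by (rule cring)
  have "\<one> \<in> PIdl \<zero> <+>\<^bsub>R\<^esub> PIdl b" using assms by simp
  then obtain y where "y \<in> carrier R" "\<one> = y \<otimes> b"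
    using assms(2) by (auto simp: set_add_def' cgenideal_def)
  then have "(y * b) mod m = 1" by (simp add: res_mult_eq res_one_eq)
  then have "[b * y = 1] (mod m)" using m_gt_one by (simp add: cong_def mult.commute)
  then show ?thesis by (auto simp: coprime_iff_invertible_int)
qed

end

theorem theorem5p4:
  fixes n :: nat
  assumes "n > 2"
  shows "eigenvalue (comaximal_laplacian n) (real n)
    \<and> (\<forall>\<mu>. eigenvalue (comaximal_laplacian n) \<mu> \<longrightarrow> \<mu> \<le> real n)
    \<and> order (real n) (char_poly (comaximal_laplacian n)) = totient n"
proof -
  let ?R = "residue_ring (int n)"
  interpret residues "int n" ?R using assms by unfold_locales auto
  have carr: "int x \<in> carrier ?R" if "x < n" for x using that by (simp add: res_carrier_eq)
  define U where "U = {k. k < n \<and> coprime k n}"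
  have sym: "comaximal_adj n i j \<longleftrightarrow> comaximal_adj n j i" for i j
    using PIdl_add_commute[of "int i" "int j"] carr by (auto simp: comaximal_adj_def)
  interpret dominated_graph n "comaximal_adj n" U 0
  proof
    show "\<not> comaximal_adj n i i" for i by (simp add: comaximal_adj_def)
    show "comaximal_adj n i j \<longleftrightarrow> comaximal_adj n j i" for i j by (rule sym)
    show "U \<subseteq> {0..<n}" by (auto simp: U_def)
    show "comaximal_adj n u j" if "u \<in> U" "j < n" "j \<noteq> u" for u j
      using that carr PIdl_coprime_add[of "int u" "int j"] by (auto simp: U_def comaximal_adj_def)
    show "0 < n" "0 \<notin> U" using assms by (auto simp: U_def)
    show "j \<in> U" if "j < n" "comaximal_adj n 0 j" for j
      using that carr coprime_if_PIdl_zero_add[of "int j"]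
      by (auto simp: U_def comaximal_adj_def res_zero_eq)
  qed
  \<comment> \<open>Vertices range over \<open>0, ..., n - 1\<close> but totatives over
    \<open>1, ..., n\<close>; neither 0 nor \<open>n\<close> is coprime to \<open>n\<close>.\<close>
  have "k < n \<longleftrightarrow> 0 < k \<and> k \<le> n" if "coprime k n" for k
    using that assms by (cases "k = 0"; cases "k = n") auto
  then have "U = totatives n" unfolding U_def totatives_def by auto
  then have order: "order (real n) (char_poly (comaximal_laplacian n)) = totient n"
    using order_char_poly_laplacian by (simp add: comaximal_laplacian_def totient_def)
  \<comment> \<open>A positive order makes \<open>n\<close> a root, so being an eigenvalue follows
    from the multiplicity.\<close>
  moreover have "totient n > 0" using assms by simp
  ultimately have "poly (char_poly (comaximal_laplacian n)) (real n) = 0"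
    using order_0I by fastforce
  then have "eigenvalue (comaximal_laplacian n) (real n)"
    by (simp add: eigenvalue_root_char_poly[of _ n] comaximal_laplacian_def)
  with order laplacian_eigenvalue_le[of "comaximal_adj n", OF sym] show ?thesis
    by (simp add: comaximal_laplacian_def)
qed

end
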